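(* Let $G$ be a finite group, let $\mathcal{L}(G)$ be its Plesken Lie algebra over a field $\mathbb{F}$ of characteristic zero, and let $V$ and $W$ be irreducible $\mathcal{L}(G)$-modules. (1) If $\theta : V \to W$ is an $\mathcal{L}(G)$-homomorphism, then either $\theta$ is an $\mathcal{L}(G)$-isomorphism or $\theta(v)=0$ for all $v\in V$. (2) If $\theta : V \to V$ is an $\mathcal{L}(G)$-isomorphism, then $\theta=\lambda I_V$ for some scalar $\lambda$, where $I_V$ is the identity map of $V$.
   Context: The group algebra $\mathbb{F}G$ is the vector space over $\mathbb{F}$ with basis $G$ and multiplication extending that of $G$ bilinearly. For $g\in G$ put $\hat g = g-g^{-1}\in\mathbb{F}G$. The Plesken Lie algebra $\mathcal{L}(G)$ of $G$ over $\mathbb{F}$ is the $\mathbb{F}$-linear span of the elements $\hat g$ ($g\in G$), with Lie bracket $[\hat g,\hat h]=\hat g\hat h-\hat h\hat g$ extended bilinearly. An $\mathcal{L}(G)$-module is a vector space $V$ over $\mathbb{F}$ with an operation $\mathcal{L}(G)\times V\to V$, $(\hat x,v)\mapsto \hat x v$, such that for all $\hat x,\hat y\in\mathcal{L}(G)$, $v,w\in V$, $a,b\in\mathbb{F}$: $(a\hat x+b\hat y)v=a(\hat xv)+b(\hat yv)$; $\hat x(av+bw)=a(\hat xv)+b(\hat xw)$; $[\hat x,\hat y]v=\hat x(\hat yv)-\hat y(\hat xv)$. A submodule of $V$ is a subspace $U$ with $\hat xu\in U$ for all $\hat x\in\mathcal{L}(G)$, $u\in U$. A module $V$ is irreducible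 if it has no proper submodule, that is, no submodule other than $\{0\}$ and $V$. An $\mathcal{L}(G)$-homomorphism is a linear map $\theta$ with $\theta(\hat xv)=\hat x\theta(v)$ for all $\hat x\in \mathcal{L}(G)$ and all $v$; an $\mathcal{L}(G)$-isomorphism is a bijective $\mathcal{L}(G)$-homomorphism.
   Formalization: Part (2) is proved with the added hypothesis that F is algebraically closed; over an arbitrary field of characteristic zero it fails (F = ℝ, G = ℤ/3, V = ℂ with g − g⁻¹ acting as i, θ = multiplication by i). *)

theory Defs
  imports Complex_Main "HOL-Library.Poly_Mapping" "HOL-Computational_Algebra.Polynomial"
begin

text \<open>
  A finite group \<open>G\<close> is a type of the classes \<^class>\<open>group_add\<close> and \<^class>\<open>finite\<close>. The class
  \<^class>\<open>group_add\<close> does not assume commutativity; the group operation is merely written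
  additively, so \<open>g + h\<close>, \<open>- g\<close> and \<open>0\<close> stand for \<open>g h\<close>, the inverse of \<open>g\<close> and the identity.
  With this convention the ring structure of \<open>'g \<Rightarrow>\<^sub>0 'f\<close> is that of the group algebra: the
  product is convolution, so the basis elements \<open>single g 1\<close> multiply as in \<open>G\<close>.
\<close>

definition galg_scale :: "'f::field \<Rightarrow> ('g \<Rightarrow>\<^sub>0 'f) \<Rightarrow> ('g \<Rightarrow>\<^sub>0 'f)"
  where "galg_scale a x = Poly_Mapping.map ((*) a) x"

lemma lookup_galg_scale [simp]: "Poly_Mapping.lookup (galg_scale a x) g = a * Poly_Mapping.lookup x g"
  unfolding galg_scale_def by transfer (simp add: when_def)

interpretation galg: vector_space "galg_scale :: 'f::field \<Rightarrow> ('g \<Rightarrow>\<^sub>0 'f) \<Rightarrow> ('g \<Rightarrow>\<^sub>0 'f)"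
  by unfold_locales (auto intro!: poly_mapping_eqI simp: lookup_add algebra_simps)

definition plesken_hat :: "'g::group_add \<Rightarrow> ('g \<Rightarrow>\<^sub>0 'f::field)"
  where "plesken_hat g = Poly_Mapping.single g 1 - Poly_Mapping.single (- g) 1"

definition plesken :: "('g::group_add \<Rightarrow>\<^sub>0 'f::field) set"
  where "plesken = galg.span {plesken_hat g | g. True}"

text \<open>
  The bracket of the generators \<^const>\<open>plesken_hat\<close>, extended bilinearly, is the restriction to
  \<^const>\<open>plesken\<close> of the commutator of the group algebra.
\<close>

definition plesken_bracket ::
    "('g::group_add \<Rightarrow>\<^sub>0 'f::field) \<Rightarrow> ('g \<Rightarrow>\<^sub>0 'f) \<Rightarrow> ('g \<Rightarrow>\<^sub>0 'f)"
  where "plesken_bracket x y = x * y - y * x"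

lemma galg_scale_mult_left: "galg_scale a x * y = galg_scale a (x * y)"
  for x y :: "'g::group_add \<Rightarrow>\<^sub>0 'f::field"
  by (simp add: galg_scale_def mult_map_scale_conv_mult mult.assoc)

lemma galg_scale_mult_right: "x * galg_scale a y = galg_scale a (x * y)"
  for x y :: "'g::group_add \<Rightarrow>\<^sub>0 'f::field"
proof -
  have "x * Poly_Mapping.single 0 a = Poly_Mapping.single 0 a * x"
  proof (induction x rule: update_induct)
    case const
    then show ?case by simp
  next
    case (update x g b)
    then have "Poly_Mapping.update g b x = x + Poly_Mapping.single g b"
      by (intro poly_mapping_eqI)
        (auto simp: lookup_update lookup_add lookup_single when_def in_keys_iff)
    with update show ?case
      by (simp add: distrib_left distrib_right mult_single mult.commute)
  qed
  then show ?thesis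
    by (simp add: galg_scale_def mult_map_scale_conv_mult flip: mult.assoc)
qed

lemma plesken_bracket_hat:
  "plesken_bracket (plesken_hat g) (plesken_hat h) =
     (plesken_hat (g + h) - plesken_hat (g - h) - plesken_hat (- g + h) + plesken_hat (- g - h)
       :: 'g::group_add \<Rightarrow>\<^sub>0 'f::field)"
proof -
  have "- (g + h) = - h - g" "- (g - h) = h - g" "- (- g + h) = - h + g" "- (- g - h) = h + g"
    by (simp_all add: minus_add minus_diff_eq)
  then show ?thesis
    by (simp add: plesken_bracket_def plesken_hat_def left_diff_distrib right_diff_distrib
        mult_single)
qed

lemma plesken_bracket_closed:
  assumes "x \<in> plesken" "y \<in> plesken"
  shows "plesken_bracket x y \<in> (plesken :: ('g::group_add \<Rightarrow>\<^sub>0 'f::field) set)"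
proof -
  have hat: "plesken_hat g \<in> (plesken :: ('g \<Rightarrow>\<^sub>0 'f) set)" for g
    unfolding plesken_def by (rule galg.span_base) auto
  have sub: "galg.subspace (plesken :: ('g \<Rightarrow>\<^sub>0 'f) set)"
    unfolding plesken_def by (rule galg.subspace_span)
  have lin_left: "plesken_bracket (galg_scale a u + v) w
      = galg_scale a (plesken_bracket u w) + plesken_bracket v w" for a and u v w :: "'g \<Rightarrow>\<^sub>0 'f"
    by (simp add: plesken_bracket_def galg_scale_mult_left galg_scale_mult_right
        algebra_simps galg.scale_right_diff_distrib)
  have lin_right: "plesken_bracket w (galg_scale a u + v)
      = galg_scale a (plesken_bracket w u) + plesken_bracket w v" for a and u v w :: "'g \<Rightarrow>\<^sub>0 'f"
    by (simp add: plesken_bracket_def galg_scale_mult_left galg_scale_mult_right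
        algebra_simps galg.scale_right_diff_distrib)
  have hat_left: "plesken_bracket (plesken_hat g) y \<in> plesken" for g
    using assms(2) unfolding plesken_def[where ?'g = 'g and ?'f = 'f]
  proof (induction rule: galg.span_induct_alt)
    case base
    then show ?case by (simp add: plesken_bracket_def galg.span_zero)
  next
    case (step c z w)
    then obtain h where z: "z = plesken_hat h" by auto
    have "plesken_bracket (plesken_hat g) z \<in> plesken"
      unfolding z plesken_bracket_hat
      by (intro galg.subspace_add[OF sub] galg.subspace_diff[OF sub] hat)
    with step show ?case
      unfolding lin_right plesken_def by (intro galg.span_add galg.span_scale)
  qed
  show ?thesis
    using assms(1) unfolding plesken_def[where ?'g = 'g and ?'f = 'f]
  proof (induction rule: galg.span_induct_alt)
    case base
    then show ?case by (simp add: plesken_bracket_def galg.span_zero)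
  next
    case (step c z w)
    then show ?case
      unfolding lin_left using hat_left
      unfolding plesken_def by (intro galg.span_add galg.span_scale) auto
  qed
qed

text \<open>
  The action is a total function on the group algebra, but only its values on
  \<^const>\<open>plesken\<close> are constrained or used. No finiteness of dimension is assumed.
\<close>

locale plesken_module = vector_space scale
  for scale :: "'f::field_char_0 \<Rightarrow> 'v::ab_group_add \<Rightarrow> 'v"
  and act :: "('g::{group_add, finite} \<Rightarrow>\<^sub>0 'f) \<Rightarrow> 'v \<Rightarrow> 'v" +
  assumes act_lin_left: "\<And>a b x y v. x \<in> plesken \<Longrightarrow> y \<in> plesken \<Longrightarrow>
      act (galg_scale a x + galg_scale b y) v = scale a (act x v) + scale b (act y v)"
    and act_lin_right: "\<And>a b x v w. x \<in> plesken \<Longrightarrow>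
      act x (scale a v + scale b w) = scale a (act x v) + scale b (act x w)"
    and act_bracket: "\<And>x y v. x \<in> plesken \<Longrightarrow> y \<in> plesken \<Longrightarrow>
      act (plesken_bracket x y) v = act x (act y v) - act y (act x v)"
begin

definition submodule :: "'v set \<Rightarrow> bool"
  where "submodule U \<longleftrightarrow> subspace U \<and> (\<forall>x\<in>plesken. \<forall>u\<in>U. act x u \<in> U)"

end

text \<open>As no further condition is imposed, the zero module counts as irreducible.\<close>

locale irreducible_plesken_module = plesken_module +
  assumes irreducible: "submodule U \<Longrightarrow> U = {0} \<or> U = UNIV"

definition plesken_hom ::
    "('f::field_char_0 \<Rightarrow> 'v::ab_group_add \<Rightarrow> 'v) \<Rightarrow>
     (('g::{group_add, finite} \<Rightarrow>\<^sub>0 'f) \<Rightarrow> 'v \<Rightarrow> 'v) \<Rightarrow>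
     ('f \<Rightarrow> 'w::ab_group_add \<Rightarrow> 'w) \<Rightarrow>
     (('g \<Rightarrow>\<^sub>0 'f) \<Rightarrow> 'w \<Rightarrow> 'w) \<Rightarrow> ('v \<Rightarrow> 'w) \<Rightarrow> bool"
  where "plesken_hom sV aV sW aW \<theta> \<longleftrightarrow>
    Vector_Spaces.linear sV sW \<theta> \<and> (\<forall>x\<in>plesken. \<forall>v. \<theta> (aV x v) = aW x (\<theta> v))"

definition plesken_iso ::
    "('f::field_char_0 \<Rightarrow> 'v::ab_group_add \<Rightarrow> 'v) \<Rightarrow>
     (('g::{group_add, finite} \<Rightarrow>\<^sub>0 'f) \<Rightarrow> 'v \<Rightarrow> 'v) \<Rightarrow>
     ('f \<Rightarrow> 'w::ab_group_add \<Rightarrow> 'w) \<Rightarrow>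
     (('g \<Rightarrow>\<^sub>0 'f) \<Rightarrow> 'w \<Rightarrow> 'w) \<Rightarrow> ('v \<Rightarrow> 'w) \<Rightarrow> bool"
  where "plesken_iso sV aV sW aW \<theta> \<longleftrightarrow> plesken_hom sV aV sW aW \<theta> \<and> bij \<theta>"

end

theory Submission
  imports Defs "HOL-Library.Multiset_Order" "HOL-Library.Product_Lexorder"
begin

text \<open>
  The first claim is Schur's argument: kernel and range of a homomorphism are submodules.

  For the second claim, let \<open>k\<close> be the algebraically closed base field. If \<open>\<theta>\<close> is not a scalar,
  then every \<open>\<theta> - c\<close> is a nonzero endomorphism, hence bijective. In finite dimension an eigenvalue
  of \<open>\<theta>\<close> contradicts this, but \<open>V\<close> may have infinite dimension, and \<open>k\<close> may be countable, so that
  no counting of dimensions helps either. The claim is then Quillen's lemma on endomorphisms of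
  simple modules over an enveloping algebra, and the proof follows Quillen in deriving it from
  generic freeness.

  Make \<open>V\<close> a module over \<open>A = k[t]\<close>, with \<open>t\<close> acting as \<open>\<theta>\<close>. It is torsion-free, because a
  nonzero polynomial is a product of linear factors and a constant. Fix a nonzero \<open>v\<close>. As \<open>V\<close> is
  irreducible, it is spanned by the vectors obtained from \<open>v\<close> by repeated action of the finitely
  many generators \<open>plesken_hat g\<close>. A commutator of two of them is a combination of generators, so
  up to shorter words the order of the letters in a word does not matter, and the sorted words,
  or monomials \<open>x\<^sup>\<alpha> v\<close>, already span \<open>V\<close>. Order the exponents \<open>\<alpha>\<close> by degree first, and let
  \<open>I\<^sub>\<alpha>\<close> be the ideal of all \<open>a\<close> in \<open>A\<close> such that \<open>a x\<^sup>\<alpha> v\<close> is a combination of smaller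
  monomials (\<open>lead_ideal\<close>). These ideals grow with \<open>\<alpha>\<close> (\<open>lead_ideal_mono\<close>), so by Dickson's
  lemma (\<open>dickson_multiset\<close>) a single nonzero \<open>f\<close> lies in all those which are nonzero
  (\<open>common_lead_coeff\<close>). The monomials with \<open>I\<^sub>\<alpha> = 0\<close> are linearly independent over \<open>A\<close>
  (\<open>independent_free_mons\<close>), and they span \<open>V\<close> once \<open>f\<close> is inverted
  (\<open>span_free_mons_localized\<close>). Since \<open>V\<close> is torsion-free, \<open>v\<close> itself belongs to this basis, and
  comparing the coefficients of \<open>v\<close> shows that any \<open>a\<close> with \<open>v \<in> a V\<close> divides a power of \<open>f\<close>
  (\<open>divisors_of_generator\<close>).

  Now choose \<open>c\<close> with \<open>f(c) \<noteq> 0\<close>, which is possible because \<open>k\<close> is infinite. As \<open>\<theta> - c\<close> is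
  surjective, \<open>t - c\<close> would have to divide a power of \<open>f\<close>, a contradiction.
\<close>

section \<open>Dickson's lemma\<close>

lemma nat_seq_incseq_subseq:
  fixes s :: "nat \<Rightarrow> nat"
  obtains r where "strict_mono r" "incseq (\<lambda>k. s (r k))"
proof -
  obtain r where r: "strict_mono r" "monoseq (\<lambda>k. s (r k))"
    using seq_monosub[of s] by blast
  show thesis
  proof (cases "incseq (\<lambda>k. s (r k))")
    case True
    with r that show ?thesis by blast
  next
    case False
    with r(2) have dec: "decseq (\<lambda>k. s (r k))"
      unfolding monoseq_iff by blast
    obtain k0 where k0: "\<And>k. s (r k0) \<le> s (r k)"
      using ex_has_least_nat[of "\<lambda>_. True" _ "\<lambda>k. s (r k)"] by auto
    have "s (r (k + k0)) = s (r k0)" for k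
      using k0[of "k + k0"] decseqD[OF dec, of k0 "k + k0"] by simp
    then have "incseq (\<lambda>k. s (r (k + k0)))"
      by (simp add: incseq_def)
    moreover have "strict_mono (\<lambda>k. r (k + k0))"
      using r(1) by (simp add: strict_mono_def)
    ultimately show ?thesis using that by blast
  qed
qed

lemma coordinatewise_incseq_subseq:
  fixes s :: "nat \<Rightarrow> 'i \<Rightarrow> nat"
  assumes "finite I"
  shows "\<exists>r. strict_mono r \<and> (\<forall>i\<in>I. incseq (\<lambda>k. s (r k) i))"
  using assms
proof (induction I)
  case empty
  show ?case using strict_mono_id by blast
next
  case (insert i I)
  then obtain r where r: "strict_mono r" "\<forall>i\<in>I. incseq (\<lambda>k. s (r k) i)" by blast
  obtain q where q: "strict_mono q" "incseq (\<lambda>k. s (r (q k)) i)"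
    using nat_seq_incseq_subseq[of "\<lambda>k. s (r k) i"] by blast
  have "strict_mono (\<lambda>k. r (q k))"
    using strict_mono_o[OF r(1) q(1)] by (simp add: o_def)
  moreover have "incseq (\<lambda>k. s (r (q k)) j)" if "j \<in> I" for j
    using r(2) that strict_mono_less_eq[OF q(1)] unfolding incseq_def by simp
  ultimately show ?case using q(2)
    by (intro exI[of _ "\<lambda>k. r (q k)"]) auto
qed

text \<open>
  \<open>F\<close> consists of the minimal elements of \<open>S\<close>. Infinitely many of them would contain two comparable
  ones, by passing to a subsequence along which every multiplicity increases.
\<close>

lemma dickson_multiset:
  fixes S :: "'a multiset set"
  assumes "finite I" and S: "\<And>\<alpha>. \<alpha> \<in> S \<Longrightarrow> set_mset \<alpha> \<subseteq> I"
  obtains F where "finite F" "F \<subseteq> S" "\<And>\<alpha>. \<alpha> \<in> S \<Longrightarrow> \<exists>\<beta>\<in>F. \<beta> \<subseteq># \<alpha>"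
proof -
  define F where "F = {\<alpha> \<in> S. \<forall>\<beta>\<in>S. \<not> \<beta> \<subset># \<alpha>}"
  have "finite F"
  proof (rule ccontr)
    assume "infinite F"
    then obtain s :: "nat \<Rightarrow> 'a multiset" where s: "inj s" "range s \<subseteq> F"
      using infinite_countable_subset by blast
    obtain r where r: "strict_mono r" "\<forall>i\<in>I. incseq (\<lambda>k. count (s (r k)) i)"
      using coordinatewise_incseq_subseq[OF \<open>finite I\<close>, of "\<lambda>k. count (s k)"] by blast
    have mem: "s k \<in> F" for k using s(2) by blast
    have "s (r 0) \<subseteq># s (r 1)"
    proof (rule mset_subset_eqI)
      fix i
      show "count (s (r 0)) i \<le> count (s (r 1)) i"
      proof (cases "i \<in> I")
        case True
        then show ?thesis using r(2) by (simp add: incseq_def)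
      next
        case False
        then have "i \<notin># s (r 0)" using mem[of "r 0"] S unfolding F_def by blast
        then show ?thesis by (simp add: not_in_iff)
      qed
    qed
    moreover have "s (r 0) \<noteq> s (r 1)"
      using s(1) r(1) by (metis inj_eq strict_mono_eq zero_neq_one)
    ultimately have "s (r 0) \<subset># s (r 1)" by (simp add: subset_mset.less_le)
    then show False using mem[of "r 0"] mem[of "r 1"] unfolding F_def by blast
  qed
  moreover have "\<exists>\<beta>\<in>F. \<beta> \<subseteq># \<alpha>" if "\<alpha> \<in> S" for \<alpha>
    using that
  proof (induction "size \<alpha>" arbitrary: \<alpha> rule: less_induct)
    case less
    show ?case
    proof (cases "\<alpha> \<in> F")
      case False
      then obtain \<beta> where \<beta>: "\<beta> \<in> S" "\<beta> \<subset># \<alpha>" using less.prems unfolding F_def by blast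
      then obtain \<gamma> where "\<gamma> \<in> F" "\<gamma> \<subseteq># \<beta>"
        using less.hyps[of \<beta>] mset_subset_size by blast
      with \<beta>(2) show ?thesis
        by (meson subset_mset.less_imp_le subset_mset.order_trans)
    qed auto
  qed
  ultimately show thesis using that[of F] unfolding F_def by blast
qed

section \<open>A monomial order on multisets\<close>

text \<open>
  Comparing the sizes first makes all words shorter than a monomial negligible against it. The
  multiset order serves only to break ties by a well-order compatible with addition.
\<close>

definition deg_key :: "nat multiset \<Rightarrow> nat \<times> nat multiset"
  where "deg_key \<alpha> = (size \<alpha>, \<alpha>)"

lemma deg_key_less_iff: "deg_key \<beta> < deg_key \<alpha> \<longleftrightarrow> size \<beta> < size \<alpha> \<or> size \<beta> = size \<alpha> \<and> \<beta> < \<alpha>"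
  by (auto simp: deg_key_def less_prod_def)

lemma deg_key_add_less: "deg_key \<beta> < deg_key \<alpha> \<Longrightarrow> deg_key (\<gamma> + \<beta>) < deg_key (\<gamma> + \<alpha>)"
  by (auto simp: deg_key_less_iff)

lemma inj_deg_key: "inj deg_key"
  by (auto simp: inj_def deg_key_def)

section \<open>Straightening of words in Lie operators\<close>

text \<open>
  The operators \<open>X i\<close> for \<open>i < n\<close> model the action of generators of a Lie algebra. It suffices that,
  at each vector, their commutators are combinations of the generators, with coefficients that may
  depend on the vector. The letters are numbers rather than abstract indices so that words can be
  sorted and monomials well-ordered.
\<close>

locale cyclic_lie_operators = module smul
  for smul :: "'a::idom \<Rightarrow> 'v::ab_group_add \<Rightarrow> 'v" (infixr \<open>\<odot>\<close> 75)
  + fixes n :: nat and X :: "nat \<Rightarrow> 'v \<Rightarrow> 'v" and v :: 'v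
  assumes X_hom: "i < n \<Longrightarrow> module_hom (\<odot>) (\<odot>) (X i)"
    and X_commutator: "i < n \<Longrightarrow> j < n \<Longrightarrow> X i (X j u) - X j (X i u) \<in> span ((\<lambda>k. X k u) ` {..<n})"
begin

definition word :: "nat list \<Rightarrow> 'v"
  where "word p = foldr X p v"

lemma word_Nil [simp]: "word [] = v" and word_Cons [simp]: "word (i # p) = X i (word p)"
  by (simp_all add: word_def)

definition words_below :: "nat \<Rightarrow> 'v set"
  where "words_below m = span {word p | p. set p \<subseteq> {..<n} \<and> length p < m}"

lemma word_in_words_below: "set p \<subseteq> {..<n} \<Longrightarrow> length p < m \<Longrightarrow> word p \<in> words_below m"
  unfolding words_below_def by (rule span_base) blast

lemma words_below_mono: "k \<le> m \<Longrightarrow> words_below k \<subseteq> words_below m"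
  unfolding words_below_def by (rule span_mono) auto

lemma X_words_below:
  assumes "i < n" "x \<in> words_below m"
  shows "X i x \<in> words_below (Suc m)"
proof -
  interpret Xi: module_hom smul smul "X i" using assms(1) by (rule X_hom)
  have "X i ` span {word p | p. set p \<subseteq> {..<n} \<and> length p < m} \<subseteq> words_below (Suc m)"
    unfolding Xi.span_image[symmetric] words_below_def
  proof (rule span_mono, clarify)
    fix p assume "set p \<subseteq> {..<n}" "length p < m"
    with assms(1) show "\<exists>q. X i (word p) = word q \<and> set q \<subseteq> {..<n} \<and> length q < Suc m"
      by (intro exI[of _ "i # p"]) simp
  qed
  with assms(2) show ?thesis unfolding words_below_def by blast
qed

lemma words_below_trans:
  "x - y \<in> words_below m \<Longrightarrow> y - z \<in> words_below m \<Longrightarrow> x - z \<in> words_below m"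
  unfolding words_below_def using span_add[of "x - y" _ "y - z"] by simp

lemma word_append_cong:
  assumes "set r \<subseteq> {..<n}" "word p - word q \<in> words_below m"
  shows "word (r @ p) - word (r @ q) \<in> words_below (length r + m)"
  using assms(1)
proof (induction r)
  case Nil
  then show ?case using assms(2) by simp
next
  case (Cons i r)
  then interpret Xi: module_hom smul smul "X i" by (intro X_hom) auto
  show ?case using X_words_below[of i, OF _ Cons.IH] Cons.prems by (simp add: Xi.diff)
qed

text \<open>
  Each exchange of neighbouring letters costs a commutator, which replaces two letters by one and so
  contributes only shorter words.
\<close>

lemma word_move_to_front:
  assumes "set (p @ i # q) \<subseteq> {..<n}"
  shows "word (p @ i # q) - word (i # p @ q) \<in> words_below (Suc (length p + length q))"
  using assms
proof (induction p)
  case Nil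
  then show ?case by (simp add: words_below_def span_zero)
next
  case (Cons j p)
  have "word (j # p @ i # q) - word (j # i # p @ q) \<in> words_below (Suc (Suc (length p + length q)))"
    using word_append_cong[of "[j]", OF _ Cons.IH] Cons.prems by simp
  moreover have "word (j # i # p @ q) - word (i # j # p @ q) \<in> words_below (Suc (Suc (length p + length q)))"
  proof -
    have "X j (X i (word (p @ q))) - X i (X j (word (p @ q)))
        \<in> span ((\<lambda>k. X k (word (p @ q))) ` {..<n})"
      using Cons.prems by (intro X_commutator) auto
    also have "\<dots> \<subseteq> words_below (Suc (Suc (length p + length q)))"
      unfolding words_below_def using Cons.prems
      by (intro span_mono) (force intro: exI[of _ "_ # p @ q"])
    finally show ?thesis by simp
  qed
  ultimately show ?case using words_below_trans by simp
qed

lemma word_perm: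
  assumes "mset p = mset q" "set p \<subseteq> {..<n}"
  shows "word p - word q \<in> words_below (length p)"
  using assms
proof (induction p arbitrary: q)
  case Nil
  then show ?case by (simp add: words_below_def span_zero)
next
  case (Cons i p)
  then have "i \<in> set q" by (metis list.set_intros(1) mset_eq_setD)
  then obtain q1 q2 where q: "q = q1 @ i # q2" by (meson split_list)
  have len: "length p = length q1 + length q2" and set_q: "set q \<subseteq> {..<n}"
    using Cons.prems mset_eq_length[OF Cons.prems(1)] mset_eq_setD[OF Cons.prems(1)] q by auto
  have "word p - word (q1 @ q2) \<in> words_below (length p)"
    using Cons.prems q by (intro Cons.IH) auto
  then have "word (i # p) - word (i # q1 @ q2) \<in> words_below (length (i # p))"
    using word_append_cong[of "[i]"] Cons.prems by simp
  moreover have "word (i # q1 @ q2) - word q \<in> words_below (length (i # p))"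
    using word_move_to_front[of q1 i q2] set_q len unfolding q words_below_def
    using span_neg[of "word (q1 @ i # q2) - word (i # q1 @ q2)"] by simp
  ultimately show ?case by (rule words_below_trans)
qed

definition mon :: "nat multiset \<Rightarrow> 'v"
  where "mon \<alpha> = word (sorted_list_of_multiset \<alpha>)"

definition exponents :: "nat multiset set"
  where "exponents = {\<alpha>. set_mset \<alpha> \<subseteq> {..<n}}"

definition mons_below :: "nat multiset \<Rightarrow> 'v set"
  where "mons_below \<alpha> = span (mon ` {\<beta> \<in> exponents. deg_key \<beta> < deg_key \<alpha>})"

lemma mon_empty [simp]: "mon {#} = v"
  by (simp add: mon_def)

lemma exponents_add [simp]: "\<alpha> + \<beta> \<in> exponents \<longleftrightarrow> \<alpha> \<in> exponents \<and> \<beta> \<in> exponents"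
  by (auto simp: exponents_def)

lemma set_sorted_exponent: "\<alpha> \<in> exponents \<Longrightarrow> set (sorted_list_of_multiset \<alpha>) \<subseteq> {..<n}"
  by (simp add: exponents_def)

lemma word_minus_mon:
  assumes "set p \<subseteq> {..<n}"
  shows "word p - mon (mset p) \<in> words_below (length p)"
  unfolding mon_def using assms by (intro word_perm) auto

text \<open>
  Spanning by sorted words, the easy half of the Poincare-Birkhoff-Witt theorem: a word differs from
  its sorted version by shorter words, to which induction applies.
\<close>

lemma words_below_subset_span_mon:
  "words_below m \<subseteq> span (mon ` {\<beta> \<in> exponents. size \<beta> < m})"
proof (induction m)
  case 0
  then show ?case by (simp add: words_below_def span_zero)
next
  case (Suc m)
  show ?case unfolding words_below_def
  proof (rule span_minimal[OF _ subspace_span], clarify)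
    fix p assume p: "set p \<subseteq> {..<n}" "length p < Suc m"
    have "word p - mon (mset p) \<in> words_below m"
      using word_minus_mon[OF p(1)] words_below_mono p(2) by (meson less_Suc_eq_le subsetD)
    also have "\<dots> \<subseteq> span (mon ` {\<beta> \<in> exponents. size \<beta> < m})" by (rule Suc.IH)
    also have "\<dots> \<subseteq> span (mon ` {\<beta> \<in> exponents. size \<beta> < Suc m})"
      by (intro span_mono) auto
    finally have "word p - mon (mset p) \<in> span (mon ` {\<beta> \<in> exponents. size \<beta> < Suc m})" .
    moreover have "mon (mset p) \<in> span (mon ` {\<beta> \<in> exponents. size \<beta> < Suc m})"
      using p by (intro span_base) (auto simp: exponents_def)
    ultimately show "word p \<in> span (mon ` {\<beta> \<in> exponents. size \<beta> < Suc m})"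
      using span_add by fastforce
  qed
qed

lemma words_below_subset_mons_below: "words_below (size \<alpha>) \<subseteq> mons_below \<alpha>"
proof -
  have "span (mon ` {\<beta> \<in> exponents. size \<beta> < size \<alpha>}) \<subseteq> mons_below \<alpha>"
    unfolding mons_below_def by (intro span_mono) (auto simp: deg_key_less_iff)
  with words_below_subset_span_mon show ?thesis by blast
qed

lemma span_words_subset_span_mon:
  "span {word p | p. set p \<subseteq> {..<n}} \<subseteq> span (mon ` exponents)"
proof (rule span_minimal[OF _ subspace_span], clarify)
  fix p assume "set p \<subseteq> {..<n}"
  then have "word p \<in> words_below (Suc (length p))" by (rule word_in_words_below) simp
  also have "\<dots> \<subseteq> span (mon ` exponents)"
    using words_below_subset_span_mon[of "Suc (length p)"]
      span_mono[of "mon ` {\<beta> \<in> exponents. size \<beta> < Suc (length p)}" "mon ` exponents"] by blast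
  finally show "word p \<in> span (mon ` exponents)" .
qed

lemma foldr_X_hom: "set p \<subseteq> {..<n} \<Longrightarrow> module_hom (\<odot>) (\<odot>) (foldr X p)"
proof (induction p)
  case Nil
  then show ?case using module_hom_ident by (simp add: id_def)
next
  case (Cons i p)
  then show ?case using module_hom_compose[of smul smul "foldr X p" smul "X i"] X_hom
    by (simp add: o_def)
qed

text \<open>
  Modulo lower degree, applying a word to a monomial adds the exponents. Together with the
  compatibility of the order with addition, this is what makes leading terms behave as in a
  commutative polynomial ring.
\<close>

lemma foldr_X_mon:
  assumes "\<alpha> \<in> exponents" "set p \<subseteq> {..<n}"
  shows "foldr X p (mon \<alpha>) - mon (mset p + \<alpha>) \<in> words_below (length p + size \<alpha>)"
proof -
  have "foldr X p (mon \<alpha>) = word (p @ sorted_list_of_multiset \<alpha>)"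
    by (simp add: mon_def word_def)
  with word_minus_mon[of "p @ sorted_list_of_multiset \<alpha>"] show ?thesis
    using assms set_sorted_exponent[OF assms(1)]
    by (simp flip: size_mset)
qed

lemma foldr_X_mons_below:
  assumes p: "set p \<subseteq> {..<n}" and x: "x \<in> mons_below \<alpha>"
  shows "foldr X p x \<in> mons_below (mset p + \<alpha>)"
proof -
  interpret Xp: module_hom smul smul "foldr X p" using p by (rule foldr_X_hom)
  have "foldr X p (mon \<beta>) \<in> mons_below (mset p + \<alpha>)"
    if \<beta>: "\<beta> \<in> exponents" "deg_key \<beta> < deg_key \<alpha>" for \<beta>
  proof -
    have "size \<beta> \<le> size \<alpha>" using \<beta>(2) by (auto simp: deg_key_less_iff)
    then have "foldr X p (mon \<beta>) - mon (mset p + \<beta>) \<in> words_below (size (mset p + \<alpha>))"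
      using foldr_X_mon[OF \<beta>(1) p] words_below_mono[of "length p + size \<beta>" "length p + size \<alpha>"]
      by auto
    then have "foldr X p (mon \<beta>) - mon (mset p + \<beta>) \<in> mons_below (mset p + \<alpha>)"
      using words_below_subset_mons_below by blast
    moreover have "mon (mset p + \<beta>) \<in> mons_below (mset p + \<alpha>)"
      unfolding mons_below_def using \<beta> p deg_key_add_less
      by (intro span_base imageI) (auto simp: exponents_def)
    ultimately show ?thesis
      unfolding mons_below_def using span_add by fastforce
  qed
  then have "foldr X p ` mons_below \<alpha> \<subseteq> mons_below (mset p + \<alpha>)"
    unfolding mons_below_def Xp.span_image[symmetric]
    by (intro span_minimal[OF _ subspace_span]) auto
  with x show ?thesis by blast
qed

section \<open>Generic freeness\<close>

text \<open>
  The quotient of the span of the monomials up to \<open>\<alpha>\<close> by \<open>mons_below \<alpha>\<close> is cyclic, and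
  \<open>lead_ideal \<alpha>\<close> is the annihilator of its generator.
\<close>

definition lead_ideal :: "nat multiset \<Rightarrow> 'a set"
  where "lead_ideal \<alpha> = {a. a \<odot> mon \<alpha> \<in> mons_below \<alpha>}"

text \<open>
  A relation with leading term \<open>a \<odot> mon \<alpha>\<close> is turned into one with leading term \<open>a \<odot> mon \<beta>\<close> by
  applying the word with exponent \<open>\<beta> - \<alpha>\<close>; the corrections that sorting brings in have smaller
  degree than \<open>\<beta>\<close>.
\<close>

lemma lead_ideal_mono:
  assumes "\<alpha> \<in> exponents" "\<beta> \<in> exponents" "\<alpha> \<subseteq># \<beta>"
  shows "lead_ideal \<alpha> \<subseteq> lead_ideal \<beta>"
proof
  fix a assume a: "a \<in> lead_ideal \<alpha>"
  define p where "p = sorted_list_of_multiset (\<beta> - \<alpha>)"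
  have p: "set p \<subseteq> {..<n}"
    unfolding p_def using assms(2) by (auto simp: exponents_def dest: in_diffD)
  have \<beta>: "\<beta> = mset p + \<alpha>" using assms(3) by (simp add: p_def)
  interpret Xp: module_hom smul smul "foldr X p" using p by (rule foldr_X_hom)
  have "a \<odot> foldr X p (mon \<alpha>) \<in> mons_below \<beta>"
    using foldr_X_mons_below[OF p, of "a \<odot> mon \<alpha>" \<alpha>] a
    by (simp add: \<beta> lead_ideal_def Xp.scale)
  moreover have "a \<odot> (foldr X p (mon \<alpha>) - mon \<beta>) \<in> mons_below \<beta>"
    using foldr_X_mon[OF assms(1) p] words_below_subset_mons_below[of \<beta>]
    unfolding mons_below_def by (intro span_scale) (auto simp: \<beta>)
  ultimately have "a \<odot> foldr X p (mon \<alpha>) - a \<odot> (foldr X p (mon \<alpha>) - mon \<beta>) \<in> mons_below \<beta>"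
    unfolding mons_below_def by (rule span_diff)
  then show "a \<in> lead_ideal \<beta>"
    by (simp add: lead_ideal_def scale_right_diff_distrib)
qed

lemma lead_ideal_mult: "a \<in> lead_ideal \<alpha> \<Longrightarrow> b * a \<in> lead_ideal \<alpha>"
  unfolding lead_ideal_def mons_below_def using span_scale[of "a \<odot> mon \<alpha>" _ b] by simp

definition free_exponents :: "nat multiset set"
  where "free_exponents = {\<alpha> \<in> exponents. lead_ideal \<alpha> \<subseteq> {0}}"

text \<open>
  \<open>f\<close> is a product of one nonzero element for each minimal exponent with nonzero ideal; it is
  nonzero as the ring has no zero divisors.
\<close>

lemma common_lead_coeff:
  obtains f where "f \<noteq> 0" "\<And>\<alpha>. \<alpha> \<in> exponents - free_exponents \<Longrightarrow> f \<in> lead_ideal \<alpha>"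
proof -
  have letters: "set_mset \<alpha> \<subseteq> {..<n}" if "\<alpha> \<in> exponents - free_exponents" for \<alpha>
    using that by (simp add: exponents_def)
  obtain F where F: "finite F" "F \<subseteq> exponents - free_exponents"
    "\<And>\<alpha>. \<alpha> \<in> exponents - free_exponents \<Longrightarrow> \<exists>\<beta>\<in>F. \<beta> \<subseteq># \<alpha>"
    using dickson_multiset[OF finite_lessThan letters] by blast
  then have "\<forall>\<beta>\<in>F. \<exists>a. a \<in> lead_ideal \<beta> \<and> a \<noteq> 0"
    unfolding free_exponents_def by blast
  then obtain a where a: "\<And>\<beta>. \<beta> \<in> F \<Longrightarrow> a \<beta> \<in> lead_ideal \<beta> \<and> a \<beta> \<noteq> 0" by metis
  show thesis
  proof (rule that)
    show "prod a F \<noteq> 0" using a F(1) by simp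
  next
    fix \<alpha> assume \<alpha>: "\<alpha> \<in> exponents - free_exponents"
    then obtain \<beta> where \<beta>: "\<beta> \<in> F" "\<beta> \<subseteq># \<alpha>" using F(3) by blast
    have "a \<beta> \<in> lead_ideal \<alpha>"
      using lead_ideal_mono[of \<beta> \<alpha>] \<alpha> \<beta> F(2) a by blast
    moreover have "prod a F = prod a (F - {\<beta>}) * a \<beta>"
      using F(1) \<beta>(1) by (simp add: prod.remove mult.commute)
    ultimately show "prod a F \<in> lead_ideal \<alpha>" by (simp add: lead_ideal_mult)
  qed
qed

text \<open>
  In a nontrivial relation, the coefficient of the largest monomial that occurs would lie in its
  leading ideal, which is zero.
\<close>

lemma independent_free_mons: "independent (mon ` free_exponents)"
proof
  assume "dependent (mon ` free_exponents)"
  then obtain T u x0 where T: "finite T" "T \<subseteq> mon ` free_exponents" "(\<Sum>x\<in>T. u x \<odot> x) = 0"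
    and x0: "x0 \<in> T" "u x0 \<noteq> 0"
    unfolding dependent_explicit by blast
  \<comment> \<open>The relation is indexed by vectors; \<open>e\<close> picks one exponent for each of them.\<close>
  define e where "e = inv_into free_exponents mon"
  have e: "e x \<in> free_exponents" "mon (e x) = x" if "x \<in> T" for x
    using that T(2) unfolding e_def by (auto intro: inv_into_into f_inv_into_f)
  define C where "C = {x \<in> T. u x \<noteq> 0}"
  have C: "finite C" "C \<noteq> {}" "C \<subseteq> T" using T(1) x0 by (auto simp: C_def)
  define M where "M = Max ((\<lambda>x. deg_key (e x)) ` C)"
  have "M \<in> (\<lambda>x. deg_key (e x)) ` C" unfolding M_def using C by (intro Max_in) auto
  then obtain y where y: "y \<in> C" "M = deg_key (e y)" by blast
  have below: "deg_key (e x) < deg_key (e y)" if "x \<in> C - {y}" for x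
  proof -
    have "deg_key (e x) \<le> deg_key (e y)"
      unfolding y(2)[symmetric] M_def using C that by (intro Max_ge) auto
    moreover have "e x \<noteq> e y" using e(2) that y(1) C(3) by (metis DiffE insertI1 subsetD)
    ultimately show ?thesis using inj_deg_key by (metis injD order_le_less)
  qed
  have "0 = (\<Sum>x\<in>C. u x \<odot> x)"
    unfolding T(3)[symmetric] using T(1) by (intro sum.mono_neutral_right) (auto simp: C_def)
  also have "\<dots> = u y \<odot> y + (\<Sum>x\<in>C - {y}. u x \<odot> x)"
    using C(1) y(1) by (rule sum.remove)
  finally have "u y \<odot> y = - (\<Sum>x\<in>C - {y}. u x \<odot> x)"
    by (simp add: eq_neg_iff_add_eq_0)
  moreover have "x \<in> mon ` {\<beta> \<in> exponents. deg_key \<beta> < deg_key (e y)}" if "x \<in> C - {y}" for x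
    using below[OF that] e[of x] that C(3) by (intro image_eqI[of _ _ "e x"]) (auto simp: free_exponents_def)
  then have "(\<Sum>x\<in>C - {y}. u x \<odot> x) \<in> mons_below (e y)"
    unfolding mons_below_def by (intro span_sum span_scale span_base)
  ultimately have "u y \<odot> y \<in> mons_below (e y)"
    unfolding mons_below_def using span_neg by simp
  then have "u y \<odot> mon (e y) \<in> mons_below (e y)"
    using e(2)[of y] y(1) C(3) by auto
  then have "u y \<in> lead_ideal (e y)" by (simp add: lead_ideal_def)
  then show False using e(1)[of y] y(1) by (auto simp: free_exponents_def C_def)
qed

text \<open>
  By well-founded induction on \<open>\<alpha>\<close>: for an exponent that is not free, multiplication by \<open>f\<close> moves
  \<open>mon \<alpha>\<close> into the span of smaller monomials. The power of \<open>f\<close> depends on \<open>w\<close>, which is why the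
  conclusion is a statement about \<open>V\<close> localized at \<open>f\<close>.
\<close>

lemma span_free_mons_localized:
  assumes f: "\<And>\<alpha>. \<alpha> \<in> exponents - free_exponents \<Longrightarrow> f \<in> lead_ideal \<alpha>"
    and w: "w \<in> span (mon ` exponents)"
  shows "\<exists>N. f ^ N \<odot> w \<in> span (mon ` free_exponents)"
proof -
  define Loc where "Loc = {x. \<exists>N. f ^ N \<odot> x \<in> span (mon ` free_exponents)}"
  have sub: "subspace Loc"
  proof (rule subspaceI)
    show "0 \<in> Loc" by (simp add: Loc_def span_zero)
  next
    fix x y assume "x \<in> Loc" "y \<in> Loc"
    then obtain N M where N: "f ^ N \<odot> x \<in> span (mon ` free_exponents)"
      and M: "f ^ M \<odot> y \<in> span (mon ` free_exponents)" by (auto simp: Loc_def)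
    have "f ^ (N + M) \<odot> (x + y) = f ^ M \<odot> f ^ N \<odot> x + f ^ N \<odot> f ^ M \<odot> y"
      by (simp add: power_add scale_right_distrib mult.commute)
    then have "f ^ (N + M) \<odot> (x + y) \<in> span (mon ` free_exponents)"
      using span_add[OF span_scale[OF N] span_scale[OF M]] by simp
    then show "x + y \<in> Loc" unfolding Loc_def by blast
  next
    fix c x assume "x \<in> Loc"
    then obtain N where N: "f ^ N \<odot> x \<in> span (mon ` free_exponents)" by (auto simp: Loc_def)
    have "f ^ N \<odot> c \<odot> x \<in> span (mon ` free_exponents)"
      unfolding scale_left_commute[of _ c] using N by (rule span_scale)
    then show "c \<odot> x \<in> Loc" unfolding Loc_def by blast
  qed
  have "mon \<alpha> \<in> Loc" if "\<alpha> \<in> exponents" for \<alpha>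
    using that
  proof (induction "deg_key \<alpha>" arbitrary: \<alpha> rule: less_induct)
    case less
    show ?case
    proof (cases "\<alpha> \<in> free_exponents")
      case True
      then have "f ^ 0 \<odot> mon \<alpha> \<in> span (mon ` free_exponents)"
        using span_base[of "mon \<alpha>" "mon ` free_exponents"] by simp
      then show ?thesis unfolding Loc_def by blast
    next
      case False
      then have "f \<odot> mon \<alpha> \<in> mons_below \<alpha>" using f less.prems by (simp add: lead_ideal_def)
      also have "mons_below \<alpha> \<subseteq> Loc"
        unfolding mons_below_def using less.hyps by (intro span_minimal[OF _ sub]) auto
      finally obtain N where "f ^ N \<odot> f \<odot> mon \<alpha> \<in> span (mon ` free_exponents)"
        unfolding Loc_def by blast
      then have "f ^ Suc N \<odot> mon \<alpha> \<in> span (mon ` free_exponents)"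
        by (simp add: mult.commute)
      then show ?thesis unfolding Loc_def by blast
    qed
  qed
  then have "span (mon ` exponents) \<subseteq> Loc" by (intro span_minimal[OF _ sub]) auto
  with w show ?thesis unfolding Loc_def by blast
qed

text \<open>
  The consequence of generic freeness that is used: \<open>v\<close> is a member of a basis after inverting
  \<open>f\<close>, so it can be divisible only by elements which become units.
\<close>

lemma divisors_of_generator:
  assumes torsion_free: "\<And>a. a \<odot> v = 0 \<Longrightarrow> a = 0"
  obtains f where "f \<noteq> 0"
    "\<And>a w. w \<in> span {word p | p. set p \<subseteq> {..<n}} \<Longrightarrow> a \<odot> w = v \<Longrightarrow> \<exists>N. a dvd f ^ N"
proof -
  obtain f where f: "f \<noteq> 0" "\<And>\<alpha>. \<alpha> \<in> exponents - free_exponents \<Longrightarrow> f \<in> lead_ideal \<alpha>"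
    using common_lead_coeff by blast
  \<comment> \<open>No exponent lies below the empty one, so its leading ideal is the annihilator of \<open>v\<close>.\<close>
  have "{#} \<in> free_exponents"
    using torsion_free
    by (auto simp: free_exponents_def exponents_def lead_ideal_def mons_below_def deg_key_less_iff)
  then have v: "v \<in> mon ` free_exponents" by (metis imageI mon_empty)
  let ?coord = "\<lambda>x. representation (mon ` free_exponents) x v"
  have "\<exists>N. a dvd f ^ N" if w: "w \<in> span {word p | p. set p \<subseteq> {..<n}}" "a \<odot> w = v" for a w
  proof -
    obtain N where N: "f ^ N \<odot> w \<in> span (mon ` free_exponents)"
      using span_free_mons_localized[OF f(2)] w(1) span_words_subset_span_mon by blast
    have "f ^ N = ?coord (f ^ N \<odot> v)"
      using v by (simp add: representation_scale independent_free_mons representation_basis span_base)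
    also have "f ^ N \<odot> v = a \<odot> f ^ N \<odot> w"
      unfolding w(2)[symmetric] by (rule scale_left_commute)
    also have "?coord \<dots> = a * ?coord (f ^ N \<odot> w)"
      using N by (simp add: representation_scale independent_free_mons del: scale_scale)
    finally show ?thesis by (metis dvd_triv_left)
  qed
  with f(1) that show thesis by blast
qed

end


section \<open>Polynomials in a linear operator\<close>

text \<open>Evaluation of \<open>p\<close> at \<open>\<theta>\<close> by Horner's rule.\<close>

definition poly_op :: "('f::field \<Rightarrow> 'v::ab_group_add \<Rightarrow> 'v) \<Rightarrow> ('v \<Rightarrow> 'v) \<Rightarrow> 'f poly \<Rightarrow> 'v \<Rightarrow> 'v"
  where "poly_op scale \<theta> p = fold_coeffs (\<lambda>a g v. scale a v + \<theta> (g v)) p (\<lambda>_. 0)"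

context
  fixes scale :: "'f::field \<Rightarrow> 'v::ab_group_add \<Rightarrow> 'v" and \<theta> :: "'v \<Rightarrow> 'v"
  assumes \<theta>: "Vector_Spaces.linear scale scale \<theta>"
begin

interpretation \<theta>: Vector_Spaces.linear scale scale \<theta>
  by (rule \<theta>)

lemma poly_op_0: "poly_op scale \<theta> 0 v = 0"
  by (simp add: poly_op_def)

lemma poly_op_pCons: "poly_op scale \<theta> (pCons a p) v = scale a v + \<theta> (poly_op scale \<theta> p v)"
  by (cases "a = 0"; cases "p = 0") (simp_all add: poly_op_def)

lemma poly_op_const: "poly_op scale \<theta> [:a:] v = scale a v"
  by (simp add: poly_op_pCons poly_op_0)

lemma poly_op_add: "poly_op scale \<theta> (p + q) v = poly_op scale \<theta> p v + poly_op scale \<theta> q v"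
  by (induction p q rule: poly_induct2)
    (simp_all add: poly_op_0 poly_op_pCons \<theta>.add \<theta>.vs1.scale_left_distrib)

lemma poly_op_smult: "poly_op scale \<theta> (smult a p) v = scale a (poly_op scale \<theta> p v)"
  by (induction p)
    (simp_all add: poly_op_0 poly_op_pCons \<theta>.scale \<theta>.vs1.scale_right_distrib)

lemma poly_op_mult: "poly_op scale \<theta> (p * q) v = poly_op scale \<theta> p (poly_op scale \<theta> q v)"
  by (induction p) (simp_all add: poly_op_0 poly_op_pCons poly_op_add poly_op_smult)

lemma poly_op_add_right: "poly_op scale \<theta> p (v + w) = poly_op scale \<theta> p v + poly_op scale \<theta> p w"
  by (induction p) (simp_all add: poly_op_0 poly_op_pCons \<theta>.add \<theta>.vs1.scale_right_distrib)

lemma module_poly_op: "module (poly_op scale \<theta>)"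
  by unfold_locales
    (simp_all add: poly_op_add poly_op_add_right poly_op_mult poly_op_const one_pCons)

lemma module_hom_poly_op:
  assumes "Vector_Spaces.linear scale scale f" and commute: "\<And>v. f (\<theta> v) = \<theta> (f v)"
  shows "module_hom (poly_op scale \<theta>) (poly_op scale \<theta>) f"
proof -
  interpret f: Vector_Spaces.linear scale scale f by fact
  have "f (poly_op scale \<theta> p v) = poly_op scale \<theta> p (f v)" for p v
    by (induction p) (simp_all add: poly_op_0 poly_op_pCons f.add f.scale commute)
  then show ?thesis
    by (simp add: module_hom_iff module_poly_op f.add)
qed

lemma poly_op_injective:
  assumes closed: "\<forall>p::'f poly. degree p > 0 \<longrightarrow> (\<exists>z. poly p z = 0)"
    and no_eigenvector: "\<And>c v. \<theta> v = scale c v \<Longrightarrow> v = 0"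
  shows "poly_op scale \<theta> p v = 0 \<Longrightarrow> v \<noteq> 0 \<Longrightarrow> p = 0"
proof (induction "degree p" arbitrary: p rule: less_induct)
  case less
  show ?case
  proof (cases "degree p = 0")
    case True
    then obtain a where p: "p = [:a:]" by (meson degree_eq_zeroE)
    then show ?thesis using less.prems by (simp add: poly_op_const)
  next
    case False
    then obtain z where "poly p z = 0" using closed by blast
    then obtain q where p: "p = [:- z, 1:] * q" by (metis poly_eq_0_iff_dvd dvdE)
    have "q \<noteq> 0" using False p by auto
    then have deg: "degree q < degree p" unfolding p by (subst degree_mult_eq) auto
    let ?w = "poly_op scale \<theta> q v"
    have "poly_op scale \<theta> [:- z, 1:] ?w = 0"
      using less.prems(1) unfolding p poly_op_mult .
    then have "\<theta> ?w = scale z ?w"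
      by (simp add: poly_op_pCons poly_op_0)
    then have "?w = 0" by (rule no_eigenvector)
    then show ?thesis using less.hyps[OF deg] less.prems(2) \<open>q \<noteq> 0\<close> by blast
  qed
qed

end

section \<open>Schur's lemma for Plesken Lie algebras\<close>

lemma hat_in_plesken: "plesken_hat g \<in> plesken"
  unfolding plesken_def by (rule galg.span_base) blast

context plesken_module
begin

lemma linear_act: "x \<in> plesken \<Longrightarrow> Vector_Spaces.linear scale scale (act x)"
  using act_lin_right[of x 1 _ 1] act_lin_right[of x _ _ 0 0]
  by unfold_locales simp_all

lemma act_mem_if_hats:
  assumes "x \<in> plesken" "subspace U" "\<And>g. act (plesken_hat g) u \<in> U"
  shows "act x u \<in> U"
proof -
  have "x \<in> galg.span {plesken_hat g | g. True}"
    using assms(1) by (simp add: plesken_def)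
  then have "act x u \<in> U \<and> x \<in> plesken"
  proof (induction rule: galg.span_induct_alt)
    case base
    have "act 0 u = 0"
      using act_lin_left[OF hat_in_plesken hat_in_plesken, of 0 _ 0 _ u] by simp
    then show ?case using assms(2) by (simp add: subspace_0 plesken_def galg.span_zero)
  next
    case (step c x y)
    then obtain g where x: "x = plesken_hat g" by blast
    have y: "y \<in> plesken" "act y u \<in> U" using step by auto
    have "act (galg_scale c x + y) u = scale c (act x u) + act y u"
      using act_lin_left[OF hat_in_plesken y(1), of c g 1 u] by (simp add: x)
    moreover have "galg_scale c x + y \<in> plesken"
      using y(1) hat_in_plesken[of g] unfolding x plesken_def
      by (intro galg.span_add galg.span_scale)
    ultimately show ?case
      using assms(2,3) y(2) by (simp add: x subspace_add subspace_scale)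
  qed
  then show ?thesis ..
qed

end

text \<open>Kernel and range are submodules, so each of them is zero or everything.\<close>

lemma hom_iso_or_zero:
  assumes "irreducible_plesken_module scaleV actV" and "irreducible_plesken_module scaleW actW"
    and hom: "plesken_hom scaleV actV scaleW actW \<theta>"
  shows "plesken_iso scaleV actV scaleW actW \<theta> \<or> (\<forall>v. \<theta> v = 0)"
proof -
  interpret V: irreducible_plesken_module scaleV actV by fact
  interpret W: irreducible_plesken_module scaleW actW by fact
  interpret \<theta>: Vector_Spaces.linear scaleV scaleW \<theta>
    using hom by (simp add: plesken_hom_def)
  have equivariant: "\<theta> (actV x v) = actW x (\<theta> v)" if "x \<in> plesken" for x v
    using hom that by (simp add: plesken_hom_def)
  have "actW x 0 = 0" if "x \<in> plesken" for x
    using W.act_lin_right[OF that, of 0 0 0 0] by simp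
  then have "V.submodule {v. \<theta> v = 0}"
    unfolding V.submodule_def using \<theta>.subspace_kernel by (auto simp: equivariant)
  then have ker: "{v. \<theta> v = 0} = {0} \<or> {v. \<theta> v = 0} = UNIV" by (rule V.irreducible)
  have "W.submodule (range \<theta>)"
    unfolding W.submodule_def using \<theta>.subspace_image[OF V.subspace_UNIV]
    by (auto simp flip: equivariant)
  then have ran: "range \<theta> = {0} \<or> range \<theta> = UNIV" by (rule W.irreducible)
  show ?thesis
  proof (cases "\<forall>v. \<theta> v = 0")
    case False
    then have "{v. \<theta> v = 0} = {0}" and "range \<theta> = UNIV" using ker ran by auto
    then have "bij \<theta>" by (auto simp: bij_def \<theta>.inj_iff_eq_0)
    with hom show ?thesis by (simp add: plesken_iso_def)
  qed blast
qed

text \<open>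
  Quillen's lemma. If \<open>\<theta>\<close> is not a scalar, then all \<open>\<theta> - c\<close> are bijective, so \<open>v\<close> is divisible by
  \<open>t - c\<close> for every \<open>c\<close>; generic freeness allows this only when \<open>c\<close> is a root of \<open>f\<close>.
\<close>

lemma hom_is_scalar:
  fixes scale :: "'f::field_char_0 \<Rightarrow> 'v::ab_group_add \<Rightarrow> 'v"
    and act :: "('g::{group_add, finite} \<Rightarrow>\<^sub>0 'f) \<Rightarrow> 'v \<Rightarrow> 'v"
  assumes "irreducible_plesken_module scale act"
    and closed: "\<forall>p::'f poly. degree p > 0 \<longrightarrow> (\<exists>z. poly p z = 0)"
    and hom: "plesken_hom scale act scale act \<theta>"
  shows "\<exists>c. \<forall>v. \<theta> v = scale c v"
proof (rule ccontr)
  assume not_scalar: "\<nexists>c. \<forall>v. \<theta> v = scale c v"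
  interpret V: irreducible_plesken_module scale act by fact
  have \<theta>: "Vector_Spaces.linear scale scale \<theta>"
    using hom by (simp add: plesken_hom_def)
  interpret \<theta>: Vector_Spaces.linear scale scale \<theta> by (rule \<theta>)
  have equivariant: "\<theta> (act x v) = act x (\<theta> v)" if "x \<in> plesken" for x v
    using hom that by (simp add: plesken_hom_def)
  have bij: "bij (\<lambda>v. \<theta> v - scale c v)" for c
  proof -
    have "plesken_hom scale act scale act (\<lambda>v. \<theta> v - scale c v)"
      unfolding plesken_hom_def
    proof (intro conjI ballI allI)
      show "Vector_Spaces.linear scale scale (\<lambda>v. \<theta> v - scale c v)"
        by unfold_locales
          (simp_all add: \<theta>.add \<theta>.scale V.scale_right_distrib V.scale_right_diff_distrib mult.commute)
    next
      fix x :: "'g \<Rightarrow>\<^sub>0 'f" and v assume x: "x \<in> plesken"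
      interpret x: Vector_Spaces.linear scale scale "act x" using x by (rule V.linear_act)
      show "\<theta> (act x v) - scale c (act x v) = act x (\<theta> v - scale c v)"
        by (simp add: equivariant[OF x] x.diff x.scale)
    qed
    then have "plesken_iso scale act scale act (\<lambda>v. \<theta> v - scale c v) \<or> (\<forall>v. \<theta> v - scale c v = 0)"
      using hom_iso_or_zero assms(1) by blast
    then show ?thesis using not_scalar by (auto simp: plesken_iso_def)
  qed
  have no_eigenvector: "v = 0" if "\<theta> v = scale c v" for c v
    using that injD[OF bij_is_inj[OF bij[of c]], of v 0] by simp
  obtain v :: 'v where "v \<noteq> 0"
    using not_scalar by (metis \<theta>.zero V.scale_zero_right)
  define n where "n = card (UNIV :: 'g set)"
  obtain e :: "nat \<Rightarrow> 'g" where "bij_betw e {0..<n} UNIV"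
    using ex_bij_betw_nat_finite[of "UNIV :: 'g set"] unfolding n_def by auto
  then have e: "e ` {..<n} = UNIV" by (simp add: bij_betw_def lessThan_atLeast0)
  define X where "X i = act (plesken_hat (e i))" for i
  \<comment> \<open>From here on \<open>V\<close> is also a module over the polynomial ring, with the indeterminate acting as \<open>\<theta>\<close>.\<close>
  let ?P = "poly_op scale \<theta>"
  interpret P: module ?P by (rule module_poly_op[OF \<theta>])
  have subspace_P_span: "V.subspace (P.span S)" for S
  proof (rule V.subspaceI)
    show "scale c x \<in> P.span S" if "x \<in> P.span S" for c x
      using P.span_scale[OF that, of "[:c:]"] by (simp add: poly_op_const[OF \<theta>])
  qed (auto intro: P.span_zero P.span_add)
  interpret cyclic_lie_operators ?P n X v
  proof (rule cyclic_lie_operators.intro[OF module_poly_op[OF \<theta>] cyclic_lie_operators_axioms.intro])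
    fix i assume "i < n"
    show "module_hom ?P ?P (X i)"
      unfolding X_def
      by (intro module_hom_poly_op[OF \<theta>] V.linear_act) (simp_all add: equivariant hat_in_plesken)
  next
    fix i j u assume "i < n" "j < n"
    let ?x = "plesken_hat (e i) :: 'g \<Rightarrow>\<^sub>0 'f" and ?y = "plesken_hat (e j) :: 'g \<Rightarrow>\<^sub>0 'f"
    have "act (plesken_bracket ?x ?y) u \<in> P.span ((\<lambda>k. X k u) ` {..<n})"
    proof (rule V.act_mem_if_hats[OF plesken_bracket_closed subspace_P_span])
      fix g
      obtain k where "k < n" "g = e k" using e by (metis UNIV_I imageE lessThan_iff)
      then show "act (plesken_hat g) u \<in> P.span ((\<lambda>k. X k u) ` {..<n})"
        by (intro P.span_base) (auto simp: X_def)
    qed (rule hat_in_plesken)+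
    then show "X i (X j u) - X j (X i u) \<in> P.span ((\<lambda>k. X k u) ` {..<n})"
      by (simp add: X_def V.act_bracket hat_in_plesken)
  qed
  \<comment> \<open>The polynomial span of the words is a submodule containing \<open>v\<close>, hence everything.\<close>
  let ?U = "P.span {word p | p. set p \<subseteq> {..<n}}"
  have X_closed: "X i u \<in> ?U" if "i < n" "u \<in> ?U" for i u
  proof -
    interpret Xi: module_hom ?P ?P "X i" using that(1) by (rule X_hom)
    have "X i ` ?U \<subseteq> ?U"
      unfolding Xi.span_image[symmetric]
    proof (rule P.span_mono, clarify)
      fix p assume "set p \<subseteq> {..<n}"
      with that(1) show "\<exists>q. X i (word p) = word q \<and> set q \<subseteq> {..<n}"
        by (intro exI[of _ "i # p"]) simp
    qed
    with that(2) show ?thesis by blast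
  qed
  have "V.submodule ?U"
    unfolding V.submodule_def
  proof (intro conjI ballI subspace_P_span)
    fix x :: "'g \<Rightarrow>\<^sub>0 'f" and u assume "x \<in> plesken" and u: "u \<in> ?U"
    show "act x u \<in> ?U"
    proof (rule V.act_mem_if_hats[OF \<open>x \<in> plesken\<close> subspace_P_span])
      fix g
      obtain k where "k < n" "g = e k" using e by (metis UNIV_I imageE lessThan_iff)
      then show "act (plesken_hat g) u \<in> ?U" using X_closed[OF _ u] by (simp add: X_def)
    qed
  qed
  moreover have "v \<in> ?U" by (rule P.span_base) (auto intro: exI[of _ "[]"])
  ultimately have U: "?U = UNIV" using V.irreducible \<open>v \<noteq> 0\<close> by blast
  have torsion_free: "p = 0" if "?P p v = 0" for p
    by (rule poly_op_injective[OF \<theta> closed _ that \<open>v \<noteq> 0\<close>]) (rule no_eigenvector)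
  obtain f where f: "f \<noteq> 0" "\<And>a w. w \<in> ?U \<Longrightarrow> ?P a w = v \<Longrightarrow> \<exists>N. a dvd f ^ N"
  proof (rule divisors_of_generator[OF torsion_free])
    fix f :: "'f poly"
    assume "f \<noteq> 0" "\<And>a w. w \<in> ?U \<Longrightarrow> ?P a w = v \<Longrightarrow> \<exists>N. a dvd f ^ N"
    then show thesis by (rule that)
  qed
  have "{c. poly f c = 0} \<noteq> UNIV"
    using poly_roots_finite[OF f(1)] infinite_UNIV_char_0[where ?'a = 'f] by auto
  then obtain c where c: "poly f c \<noteq> 0" by blast
  obtain w where "v = \<theta> w - scale c w"
    using surjD[OF bij_is_surj[OF bij[of c]], of v] by blast
  then have divides: "?P [:- c, 1:] w = v" by (simp add: poly_op_pCons[OF \<theta>] poly_op_0[OF \<theta>])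
  have "w \<in> ?U" unfolding U by (rule UNIV_I)
  from f(2)[OF this divides] obtain N where "[:- c, 1:] dvd f ^ N" ..
  then have "poly (f ^ N) c = 0" by (simp only: poly_eq_0_iff_dvd)
  then show False using c by simp
qed

theorem theorem4:
  fixes scaleV :: "'f::field_char_0 \<Rightarrow> 'v::ab_group_add \<Rightarrow> 'v"
    and actV :: "('g::{group_add, finite} \<Rightarrow>\<^sub>0 'f) \<Rightarrow> 'v \<Rightarrow> 'v"
    and scaleW :: "'f \<Rightarrow> 'w::ab_group_add \<Rightarrow> 'w"
    and actW :: "('g \<Rightarrow>\<^sub>0 'f) \<Rightarrow> 'w \<Rightarrow> 'w"
  assumes V: "irreducible_plesken_module scaleV actV"
    and W: "irreducible_plesken_module scaleW actW"
  shows "(\<forall>\<theta>. plesken_hom scaleV actV scaleW actW \<theta> \<longrightarrow>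
            plesken_iso scaleV actV scaleW actW \<theta> \<or> (\<forall>v. \<theta> v = 0))
       \<and> ((\<forall>p::'f poly. degree p > 0 \<longrightarrow> (\<exists>z. poly p z = 0)) \<longrightarrow>
          (\<forall>\<theta>. plesken_iso scaleV actV scaleV actV \<theta> \<longrightarrow>
            (\<exists>c. \<forall>v. \<theta> v = scaleV c v)))"
proof (intro conjI allI impI)
  fix \<theta> assume "plesken_hom scaleV actV scaleW actW \<theta>"
  then show "plesken_iso scaleV actV scaleW actW \<theta> \<or> (\<forall>v. \<theta> v = 0)"
    by (rule hom_iso_or_zero[OF V W])
next
  fix \<theta>
  assume closed: "\<forall>p::'f poly. degree p > 0 \<longrightarrow> (\<exists>z. poly p z = 0)"
    and "plesken_iso scaleV actV scaleV actV \<theta>"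
  then show "\<exists>c. \<forall>v. \<theta> v = scaleV c v"
    by (intro hom_is_scalar[OF V closed]) (simp add: plesken_iso_def)
qed

end
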